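(* For $n\in\mathbb N$ let $c_j^{(n)}$, $j=0,\dots,n-1$, be the coefficient of $z^j$ in $p_n(z)=(1+z)(1+2z)\cdots(1+(n-1)z)$, and set $c_j^{(n)}=0$ for $j\ge n$. Then: 1. $\sum_{j=0}^{n-1}c_j^{(n)}=n!$ for every $n\in\mathbb N$. 2. $c_j^{(n)}\le\frac{n!}{2}$ for every $j\in\mathbb N_0$ and every $n\ge2$. 3. For every fixed $j\in\mathbb N_0$, $\lim_{n\to+\infty}\frac{c_j^{(n)}}{n!}=0$. 4. For every $n\in\mathbb N$, $c_{n-1}^{(n)}=(n-1)!$, and $c_{n-2}^{(n)}\sim(\gamma+\log n)(n-1)!$ (as $n\to+\infty$), where $\gamma=\lim_{n\to+\infty}\big(\sum_{j=1}^n\frac1j-\log n\big)$ is the Euler–Mascheroni constant. More generally, for every fixed $j\in\mathbb N$, $$c_{n-j}^{(n)}\lesssim(\gamma+\log n)^{j-1}(n-1)!,$$ where $\lesssim$ means inequality up to some constant independent of $j$ and $n$. Hence, in particular, $\lim_{n\to+\infty}\frac{c_{n-j}^{(n)}}{n!}=0$.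
   Context: $\mathbb N=\{1,2,\dots\}$, $\mathbb N_0=\{0,1,2,\dots\}$; $p_1(z)=1$ (empty product); $a_n\sim b_n$ means $a_n/b_n\to1$. *)

theory Defs
  imports "HOL-Analysis.Harmonic_Numbers" "HOL-Computational_Algebra.Polynomial"
begin

definition p :: "nat \<Rightarrow> real poly" where
  "p n = (\<Prod>k = 1..n - 1. [:1, real k:])"

(* c n j is the paper's c_j^(n); it vanishes for j >= n because p n has degree n - 1 (see c_eq_0). *)
definition c :: "nat \<Rightarrow> nat \<Rightarrow> real" where
  "c n j = coeff (p n) j"

lemma c_eq_0:
  assumes "n \<ge> 1" "j \<ge> n"
  shows "c n j = 0"
proof -
  have "degree (p n) \<le> (\<Sum>k = 1..n - 1. degree [:1, real k:])"
    unfolding p_def using degree_prod_sum_le[of "{1..n - 1}" "\<lambda>k. [:1, real k:]"]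
    by (simp add: o_def)
  also have "\<dots> \<le> (\<Sum>k = 1..n - 1. 1)"
    by (intro sum_mono) auto
  finally have "degree (p n) < j"
    using assms by simp
  thus ?thesis
    by (simp add: c_def coeff_eq_0)
qed

end

theory Submission
  imports Defs "HOL-Real_Asymp.Real_Asymp"
begin

text \<open>
  The sum of the coefficients is the value of \<open>p n\<close> at 1; the rest follows from the recurrence
  \<open>c (n + 1) (j + 1) = c n (j + 1) + n * c n j\<close>.
  The quotient \<open>c (m + 1) (m - i) / m!\<close> is the \<open>i\<close>-th elementary symmetric function of
  \<open>1, 1/2, \<dots>, 1/m\<close>; hence it equals the harmonic number \<open>H m\<close> for \<open>i = 1\<close>, is at most
  \<open>(H m) ^ i\<close> in general, and \<open>H m \<le> \<gamma> + ln (m + 1)\<close> makes the constant \<open>C = 1\<close> suffice.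
\<close>

section \<open>Recurrence and sign of the coefficients\<close>

lemma c_1 [simp]: "c (Suc 0) j = (if j = 0 then 1 else 0)"
  by (simp add: c_def p_def)

lemma p_Suc_Suc: "p (Suc (Suc n)) = p (Suc n) * [:1, real (Suc n):]"
  by (simp add: p_def)

lemma c_Suc_Suc: "c (Suc (Suc n)) (Suc j) = c (Suc n) (Suc j) + real (Suc n) * c (Suc n) j"
  by (simp add: c_def p_Suc_Suc algebra_simps)

lemma c_Suc_0 [simp]: "c (Suc n) 0 = 1"
proof (induction n)
  case (Suc n)
  then show ?case by (simp add: c_def p_Suc_Suc)
qed simp

lemma c_nonneg: "c (Suc n) j \<ge> 0"
proof (induction n arbitrary: j)
  case (Suc n)
  then show ?case by (cases j) (simp_all add: c_Suc_Suc)
qed simp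

section \<open>Coefficient sum and bounds at a fixed index\<close>

lemma sum_c_eq_fact: "(\<Sum>j\<le>n. c (Suc n) j) = fact (Suc n)"
proof -
  have "degree (p (Suc n)) \<le> n"
    by (rule degree_le) (use c_eq_0[of "Suc n"] in \<open>auto simp: c_def\<close>)
  hence "(\<Sum>j\<le>n. c (Suc n) j) = poly (p (Suc n)) 1"
    \<comment> \<open>\<open>poly_altdef\<close> sums only up to the degree; the remaining
      coefficients up to \<open>n\<close> vanish.\<close>
    by (auto simp: c_def poly_altdef intro!: sum.mono_neutral_right le_degree)
  also have "\<dots> = (\<Prod>k = 1..n. real (Suc k))"
    by (simp add: p_def poly_prod add.commute)
  also have "\<dots> = fact (Suc n)"
    by (induction n) (simp_all add: algebra_simps)
  finally show ?thesis .
qed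

text \<open>The recurrence preserves the bound, since n!/2 + n * n!/2 = (n+1)!/2. The constant
  coefficient lies outside the recurrence but is always 1.\<close>

lemma c_le_half_fact:
  assumes "n \<ge> 2"
  shows "c n j \<le> fact n / 2"
  using assms
proof (induction n arbitrary: j rule: nat_induct_at_least)
  case base
  have "c 2 j \<le> 1"
    by (cases j) (simp_all add: numeral_2_eq_2 c_Suc_Suc)
  then show ?case by simp
next
  case (Suc n)
  obtain m where m: "n = Suc m"
    using Suc.hyps by (cases n) auto
  show ?case
  proof (cases j)
    case 0
    have "(2 :: real) \<le> fact (Suc n)"
      using fact_mono[of 2 "Suc n", where 'a = real] Suc.hyps by simp
    then show ?thesis by (simp add: 0)
  next
    case (Suc i)
    have "c (Suc n) j = c n (Suc i) + real n * c n i"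
      by (simp add: Suc m c_Suc_Suc)
    also have "\<dots> \<le> fact n / 2 + real n * (fact n / 2)"
      by (intro add_mono mult_left_mono Suc.IH) simp
    also have "\<dots> = fact (Suc n) / 2"
      by (simp add: field_simps)
    finally show ?thesis .
  qed
qed

text \<open>Induction on \<open>j\<close>: after division by (n+2)!, the first summand of the
  recurrence is at most 1/(n+2), and the second is at most the quotient for \<open>j\<close> at
  n+1.\<close>

lemma c_div_fact_tendsto_0: "(\<lambda>n. c n j / fact n) \<longlonglongrightarrow> 0"
proof (induction j)
  case 0
  have "(\<lambda>n. c (Suc n) 0 / fact (Suc n)) \<longlonglongrightarrow> 0"
    \<comment> \<open>The numbers 1/n! are the terms of the convergent exponential series at
      1.\<close>
    using LIMSEQ_Suc[OF summable_LIMSEQ_zero[OF summable_exp[of "1 :: real"]]]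
    by (simp add: inverse_eq_divide del: fact_Suc)
  then show ?case by (rule LIMSEQ_imp_Suc)
next
  case (Suc j)
  have lim: "(\<lambda>n. 1 / real (Suc (Suc n)) + c (Suc n) j / fact (Suc n)) \<longlonglongrightarrow> 0 + 0"
    by (intro tendsto_add LIMSEQ_Suc[OF Suc.IH]) real_asymp
  have le: "c (Suc (Suc n)) (Suc j) / fact (Suc (Suc n))
      \<le> 1 / real (Suc (Suc n)) + c (Suc n) j / fact (Suc n)" for n
  proof -
    have "c (Suc n) (Suc j) \<le> fact (Suc n)"
    \<comment> \<open>The half-factorial bound starts at index 2; for \<open>n = 0\<close> the
      coefficient is 0.\<close>
    proof (cases n)
      case (Suc m)
      have "c (Suc n) (Suc j) \<le> fact (Suc n) / 2"
        by (rule c_le_half_fact) (simp add: Suc)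
      also have "\<dots> \<le> fact (Suc n)"
        by (simp del: fact_Suc)
      finally show ?thesis .
    qed simp
    moreover have "real (Suc n) * c (Suc n) j \<le> real (Suc (Suc n)) * c (Suc n) j"
      by (intro mult_right_mono c_nonneg) simp
    ultimately have "c (Suc (Suc n)) (Suc j)
        \<le> fact (Suc n) + real (Suc (Suc n)) * c (Suc n) j"
      by (simp add: c_Suc_Suc)
    then have "c (Suc (Suc n)) (Suc j) / fact (Suc (Suc n))
        \<le> (fact (Suc n) + real (Suc (Suc n)) * c (Suc n) j) / fact (Suc (Suc n))"
      by (intro divide_right_mono) auto
    also have "\<dots> = 1 / real (Suc (Suc n)) + c (Suc n) j / fact (Suc n)"
      unfolding fact_Suc[of "Suc n"]
      by (simp add: add_divide_distrib del: fact_Suc of_nat_Suc)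
    finally show ?thesis .
  qed
  have "(\<lambda>n. c (Suc (Suc n)) (Suc j) / fact (Suc (Suc n))) \<longlonglongrightarrow> 0"
  proof (rule tendsto_sandwich[OF _ _ tendsto_const])
    show "\<forall>\<^sub>F n in sequentially. 0 \<le> c (Suc (Suc n)) (Suc j) / fact (Suc (Suc n))"
      by (intro always_eventually allI divide_nonneg_nonneg c_nonneg fact_ge_zero)
    show "\<forall>\<^sub>F n in sequentially. c (Suc (Suc n)) (Suc j) / fact (Suc (Suc n))
        \<le> 1 / real (Suc (Suc n)) + c (Suc n) j / fact (Suc n)"
      by (intro always_eventually allI le)
    show "(\<lambda>n. 1 / real (Suc (Suc n)) + c (Suc n) j / fact (Suc n)) \<longlonglongrightarrow> 0"
      using lim by (simp only: add_0)
  qed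
  then have "(\<lambda>n. c (Suc n) (Suc j) / fact (Suc n)) \<longlonglongrightarrow> 0"
    by (rule LIMSEQ_imp_Suc)
  then show ?case
    by (rule LIMSEQ_imp_Suc)
qed

section \<open>Coefficients counted from the top\<close>

lemma c_leading: "c (Suc m) m = fact m"
  by (induction m) (simp_all add: c_Suc_Suc c_eq_0 algebra_simps)

lemma c_subleading: "c (Suc (Suc m)) m = harm (Suc m) * fact (Suc m)"
proof (induction m)
  case 0
  then show ?case by (simp add: harm_def)
next
  case (Suc m)
  then show ?case
    by (simp add: c_Suc_Suc[of "Suc m"] c_leading harm_Suc[of "Suc m"] field_simps)
qed

text \<open>With e_i(m) for the quotient by m! and H for \<open>harm m\<close>, the recurrence reads
  e_(k+1)(m+1) = e_(k+1)(m) + e_k(m)/(m+1). By induction this is at most H^k (H + 1/(m+1)), and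
  enlarging H^k completes the power.\<close>

lemma c_le_harm_power:
  "i \<le> m \<Longrightarrow> c (Suc m) (m - i) \<le> harm m ^ i * fact m"
proof (induction m arbitrary: i)
  case 0
  then show ?case by simp
next
  case (Suc m)
  show ?case
  proof (cases i)
    case 0
    then show ?thesis by (simp add: c_leading)
  next
    case (Suc k)
    have k: "k \<le> m" using Suc Suc.prems by simp
    have *: "c (Suc m) (m - k) \<le> harm m ^ k * fact m"
      by (rule Suc.IH) (use k in auto)
    define H :: real where "H = harm m"
    have H: "H \<ge> 0" "harm (Suc m) = H + 1 / real (Suc m)"
      by (simp_all add: H_def harm_nonneg harm_Suc field_simps)
    have "c (Suc (Suc m)) (m - k) \<le> H ^ k * fact m + real (Suc m) * (H ^ Suc k * fact m)"
    \<comment> \<open>For \<open>m = k\<close> the coefficient is the constant one, equal to 1 at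
      every index, so \<open>*\<close> already bounds it by the first summand.\<close>
    proof (cases "m - k")
      case 0
      then show ?thesis using * H by (simp add: H_def add_increasing2)
    next
      case (Suc r)
      hence r: "r = m - Suc k" "Suc k \<le> m" by auto
      show ?thesis
        unfolding Suc c_Suc_Suc
        using * Suc.IH[OF r(2)]
        by (intro add_mono mult_left_mono) (simp_all add: Suc r(1)[symmetric] H_def)
    qed
    also have "\<dots> = fact (Suc m) * (H ^ k * (H + 1 / real (Suc m)))"
      by (simp add: field_simps)
    also have "\<dots> \<le> fact (Suc m) * ((H + 1 / real (Suc m)) ^ k * (H + 1 / real (Suc m)))"
      using H by (intro mult_left_mono mult_right_mono power_mono) auto
    finally show ?thesis
      by (simp add: Suc H(2) mult_ac del: fact_Suc of_nat_Suc)
  qed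
qed

text \<open>The shift to \<open>Suc m\<close> is essential: H_m - ln m decreases to \<gamma> from
  above, whereas H_m - ln (m+1) stays below it.\<close>

lemma harm_le_euler_mascheroni_add_ln: "harm m \<le> euler_mascheroni + ln (real (Suc m))"
proof (cases m)
  case 0
  then show ?thesis using euler_mascheroni_pos by (simp add: harm_def)
next
  case (Suc k)
  have "harm (Suc k) - ln (real (k + 2)) \<le> harm (Suc k) - ln (real (k + 2)) + 1 / real (2 * (k + 2))"
    by simp
  also have "\<dots> \<le> euler_mascheroni"
    by (rule euler_mascheroni_lower)
  finally show ?thesis by (simp add: Suc)
qed

text \<open>With n = m+1 the bound on \<open>harm m\<close> is exactly \<gamma> + ln n, so no extra
  factor depending on \<open>j\<close> arises.\<close>

lemma c_diff_le:
  assumes "1 \<le> j" "j \<le> n"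
  shows "c n (n - j) \<le> (euler_mascheroni + ln (real n)) ^ (j - 1) * fact (n - 1)"
proof -
  obtain i m where im: "j = Suc i" "n = Suc m"
    using assms by (metis Suc_le_D One_nat_def)
  have "c (Suc m) (m - i) \<le> harm m ^ i * fact m"
    using assms im by (intro c_le_harm_power) auto
  also have "\<dots> \<le> (euler_mascheroni + ln (real (Suc m))) ^ i * fact m"
    by (intro mult_right_mono power_mono harm_le_euler_mascheroni_add_ln harm_nonneg) auto
  finally show ?thesis by (simp add: im)
qed

text \<open>The quotient is H_(n-1)/L with L = \<gamma> + ln n. Writing H_(n-1) = L + (H_n - ln n -
  1/n - \<gamma>) leaves 1 plus a convergent term divided by L, which tends to infinity.\<close>

lemma c_diff_2_asymp:
  "(\<lambda>n. c n (n - 2) / ((euler_mascheroni + ln (real n)) * fact (n - 1))) \<longlonglongrightarrow> 1"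
proof -
  have inf: "filterlim (\<lambda>n. euler_mascheroni + ln (real n)) at_top sequentially"
    by real_asymp
  have "(\<lambda>n. (harm n - ln (real n)) - 1 / real n - euler_mascheroni) \<longlonglongrightarrow>
      euler_mascheroni - 0 - euler_mascheroni"
    by (intro tendsto_diff tendsto_const euler_mascheroni_LIMSEQ) real_asymp
  hence "(\<lambda>n. 1 + ((harm n - ln (real n)) - 1 / real n - euler_mascheroni) /
      (euler_mascheroni + ln (real n))) \<longlonglongrightarrow> 1 + 0"
    by (intro tendsto_add tendsto_const tendsto_divide_0[OF _ filterlim_at_top_imp_at_infinity[OF inf]])
  hence lim: "(\<lambda>n. 1 + ((harm n - ln (real n)) - 1 / real n - euler_mascheroni) /
      (euler_mascheroni + ln (real n))) \<longlonglongrightarrow> 1" by simp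
  show ?thesis
  proof (rule Lim_transform_eventually[OF lim])
    show "\<forall>\<^sub>F n in sequentially.
        1 + ((harm n - ln (real n)) - 1 / real n - euler_mascheroni) / (euler_mascheroni + ln (real n))
        = c n (n - 2) / ((euler_mascheroni + ln (real n)) * fact (n - 1))"
      using eventually_ge_at_top[of 2]
    proof eventually_elim
      case (elim n)
      then obtain m where n: "n = Suc (Suc m)"
        by (metis Suc_le_D numeral_2_eq_2 Suc_le_mono)
      define L where "L = euler_mascheroni + ln (real n)"
      have "L > 0"
        using euler_mascheroni_pos elim by (auto simp: L_def intro!: add_pos_nonneg)
      have "harm n - ln (real n) - 1 / real n - euler_mascheroni = harm (Suc m) - L"
        by (simp add: n harm_Suc[of "Suc m"] L_def inverse_eq_divide)
      moreover have "c n (n - 2) = harm (Suc m) * fact (n - 1)"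
        using c_subleading[of m] by (simp add: n)
      ultimately show ?case
        using \<open>L > 0\<close> unfolding L_def[symmetric] by (simp add: field_simps)
    qed
  qed
qed

text \<open>Dividing the bound of \<open>c_diff_le\<close> by n! leaves a fixed power of a logarithm
  over n.\<close>

lemma c_diff_div_fact_tendsto_0:
  assumes "j \<ge> 1"
  shows "(\<lambda>n. c n (n - j) / fact n) \<longlonglongrightarrow> 0"
proof (rule tendsto_sandwich[OF _ _ tendsto_const])
  show "(\<lambda>n. (euler_mascheroni + ln (real n)) ^ (j - 1) / real n) \<longlonglongrightarrow> 0"
    by real_asymp
  have ev: "\<forall>\<^sub>F n in sequentially. n \<ge> j" by (rule eventually_ge_at_top)
  show "\<forall>\<^sub>F n in sequentially. 0 \<le> c n (n - j) / fact n"
    using ev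
  proof eventually_elim
    case (elim n)
    then show ?case using assms c_nonneg[of "n - 1" "n - j"] by simp
  qed
  show "\<forall>\<^sub>F n in sequentially.
      c n (n - j) / fact n \<le> (euler_mascheroni + ln (real n)) ^ (j - 1) / real n"
    using ev
  proof eventually_elim
    case (elim n)
    have "c n (n - j) / fact n \<le> (euler_mascheroni + ln (real n)) ^ (j - 1) * fact (n - 1) / fact n"
      by (intro divide_right_mono c_diff_le assms elim) simp
    also have "\<dots> = (euler_mascheroni + ln (real n)) ^ (j - 1) / real n"
      using assms elim by (simp add: fact_reduce[of n])
    finally show ?case .
  qed
qed

text \<open>\<open>C\<close> is chosen before \<open>j\<close> and \<open>n\<close>, hence uniform
  in both; \<open>n \<ge> j\<close> keeps the natural subtraction from truncating.\<close>

theorem proposition3p2: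
  shows "(\<forall>n\<ge>1. (\<Sum>j = 0..n - 1. c n j) = fact n)
    \<and> (\<forall>j. \<forall>n\<ge>2. c n j \<le> fact n / 2)
    \<and> (\<forall>j. (\<lambda>n. c n j / fact n) \<longlonglongrightarrow> 0)
    \<and> (\<forall>n\<ge>1. c n (n - 1) = fact (n - 1))
    \<and> (\<lambda>n. c n (n - 2) / ((euler_mascheroni + ln (real n)) * fact (n - 1))) \<longlonglongrightarrow> 1
    \<and> (\<exists>C>0. \<forall>j\<ge>1. \<forall>n\<ge>j. c n (n - j) \<le> C * ((euler_mascheroni + ln (real n)) ^ (j - 1) * fact (n - 1)))
    \<and> (\<forall>j\<ge>1. (\<lambda>n. c n (n - j) / fact n) \<longlonglongrightarrow> 0)"
proof (intro conjI)
  show "\<forall>n\<ge>1. (\<Sum>j = 0..n - 1. c n j) = fact n"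
  proof (intro allI impI)
    fix n :: nat
    assume "n \<ge> 1"
    then show "(\<Sum>j = 0..n - 1. c n j) = fact n"
      using sum_c_eq_fact[of "n - 1"] by (simp add: atMost_atLeast0)
  qed
  show "\<forall>n\<ge>1. c n (n - 1) = fact (n - 1)"
  proof (intro allI impI)
    fix n :: nat
    assume "n \<ge> 1"
    then show "c n (n - 1) = fact (n - 1)"
      using c_leading[of "n - 1"] by simp
  qed
  show "\<exists>C>0. \<forall>j\<ge>1. \<forall>n\<ge>j.
      c n (n - j) \<le> C * ((euler_mascheroni + ln (real n)) ^ (j - 1) * fact (n - 1))"
    by (rule exI[of _ 1]) (use c_diff_le in auto)
qed (use c_le_half_fact c_div_fact_tendsto_0 c_diff_2_asymp c_diff_div_fact_tendsto_0 in blast)+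

end
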